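(* Let $G$ be a diffeological group with a smooth action $\sigma:\mathbb Z_2\to\operatorname{Aut}(G)$, $\varepsilon\mapsto\sigma_\varepsilon$, and let $H_\sigma=G\rtimes_\sigma\mathbb Z_2$ with product $(g,\varepsilon)(g',\varepsilon')=(g\,\sigma_\varepsilon(g'),\varepsilon\varepsilon')$. Let $P\to X$ be a principal $H_\sigma$-bundle over a diffeological space $X$, trivialized over an open cover $(U_i)_i$, and write its transition functions as $h_{ij}=(g_{ij},\varepsilon_{ij}):U_{ij}\to G\rtimes_\sigma\mathbb Z_2$. Then the functions $\varepsilon_{ij}$ define a $\mathbb Z_2$-valued Čech cocycle, hence a class $$\alpha(P)=[\varepsilon_{ij}]\in H^1(X;\mathbb Z_2),$$ and the functions $g_{ij}$ satisfy the twisted cocycle relation $$g_{ij}\,\sigma_{\varepsilon_{ij}}(g_{jk})=g_{ik}\qquad\text{on }U_{ijk}.$$ Thus the pair $(\varepsilon_{ij},g_{ij})$ defines a non-abelian $G$-valued cocycle twisted by the local system associated with $\alpha(P)$.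
   Context: $\mathbb Z_2=\{\pm1\}$. $U_{ij}=U_i\cap U_j$, $U_{ijk}=U_i\cap U_j\cap U_k$; open means open in the $D$-topology. The transition functions are the smooth maps with $s_j=s_ih_{ij}$ for local sections $s_i:U_i\to P$, so that $h_{ij}h_{jk}=h_{ik}$ on $U_{ijk}$. A "non-abelian $G$-valued cocycle twisted by the local system" given by a $\mathbb Z_2$-cocycle $(\varepsilon_{ij})$ means, by definition, a family $(g_{ij})$ of $G$-valued functions satisfying $g_{ij}\sigma_{\varepsilon_{ij}}(g_{jk})=g_{ik}$. *)

theory Defs
  imports "HOL-Analysis.Analysis" "HOL-Algebra.Bij"
begin

section \<open>Smooth maps between open subsets of Euclidean spaces\<close>

text \<open>
  The dimension has to range over all natural numbers inside the axioms of a diffeology, so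
  R^n is taken to be the carrier of \<^term>\<open>Euclidean_space n\<close>: the sequences \<open>x :: nat \<Rightarrow> real\<close>
  with \<open>x i = 0\<close> for \<open>i \<ge> n\<close>.
\<close>

text \<open>Only the values of \<open>f\<close> on the open set \<open>U\<close> matter, as derivatives are local.\<close>

primrec Ck_on :: "nat \<Rightarrow> nat \<Rightarrow> (nat \<Rightarrow> real) set \<Rightarrow> ((nat \<Rightarrow> real) \<Rightarrow> real) \<Rightarrow> bool" where
  "Ck_on 0 n U f \<longleftrightarrow>
     continuous_map (subtopology (Euclidean_space n) U) euclideanreal f"
| "Ck_on (Suc k) n U f \<longleftrightarrow>
     continuous_map (subtopology (Euclidean_space n) U) euclideanreal f \<and>
     (\<forall>i<n. \<exists>f'. (\<forall>x\<in>U. ((\<lambda>t. f (x(i := t))) has_real_derivative f' x) (at (x i))) \<and>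
                 Ck_on k n U f')"

definition smooth_euclidean ::
    "nat \<Rightarrow> (nat \<Rightarrow> real) set \<Rightarrow> nat \<Rightarrow> (nat \<Rightarrow> real) set \<Rightarrow> ((nat \<Rightarrow> real) \<Rightarrow> (nat \<Rightarrow> real)) \<Rightarrow> bool" where
  "smooth_euclidean m V n U F \<longleftrightarrow>
     F \<in> V \<rightarrow> U \<and> (\<forall>i<n. \<forall>k. Ck_on k m V (\<lambda>x. F x i))"


section \<open>Diffeological spaces\<close>

text \<open>\<open>D n U p\<close> means that \<open>p\<close>, restricted to the open set \<open>U\<close> of R^n, is a plot.\<close>

type_synonym 'a plots = "nat \<Rightarrow> (nat \<Rightarrow> real) set \<Rightarrow> ((nat \<Rightarrow> real) \<Rightarrow> 'a) \<Rightarrow> bool"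

locale diffeological_space =
  fixes X :: "'a set" and D :: "'a plots"
  assumes plot_domain: "D n U p \<Longrightarrow> openin (Euclidean_space n) U"
    and plot_range: "D n U p \<Longrightarrow> p \<in> U \<rightarrow> X"
    and plot_cong: "\<lbrakk>D n U p; \<And>u. u \<in> U \<Longrightarrow> q u = p u\<rbrakk> \<Longrightarrow> D n U q"
    and plot_const: "\<lbrakk>openin (Euclidean_space n) U; c \<in> X\<rbrakk> \<Longrightarrow> D n U (\<lambda>_. c)"
    and plot_local:
      "\<lbrakk>openin (Euclidean_space n) U; \<And>u. u \<in> U \<Longrightarrow> \<exists>V. u \<in> V \<and> V \<subseteq> U \<and> D n V p\<rbrakk> \<Longrightarrow> D n U p"
    and plot_compose:
      "\<lbrakk>D n U p; openin (Euclidean_space m) V; smooth_euclidean m V n U F\<rbrakk> \<Longrightarrow> D m V (p \<circ> F)"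

definition smooth_map :: "'a set \<Rightarrow> 'a plots \<Rightarrow> 'b set \<Rightarrow> 'b plots \<Rightarrow> ('a \<Rightarrow> 'b) \<Rightarrow> bool" where
  "smooth_map X DX Y DY f \<longleftrightarrow>
     f \<in> X \<rightarrow> Y \<and> (\<forall>n U p. DX n U p \<longrightarrow> DY n U (f \<circ> p))"

definition diffeomorphism :: "'a set \<Rightarrow> 'a plots \<Rightarrow> 'b set \<Rightarrow> 'b plots \<Rightarrow> ('a \<Rightarrow> 'b) \<Rightarrow> bool" where
  "diffeomorphism X DX Y DY f \<longleftrightarrow>
     bij_betw f X Y \<and> smooth_map X DX Y DY f \<and> smooth_map Y DY X DX (inv_into X f)"

definition subset_plots :: "'a plots \<Rightarrow> 'a set \<Rightarrow> 'a plots" where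
  "subset_plots D A n U p \<longleftrightarrow> D n U p \<and> p \<in> U \<rightarrow> A"

definition prod_plots :: "'a plots \<Rightarrow> 'b plots \<Rightarrow> ('a \<times> 'b) plots" where
  "prod_plots D E n U p \<longleftrightarrow> D n U (fst \<circ> p) \<and> E n U (snd \<circ> p)"

definition discrete_plots :: "'a set \<Rightarrow> 'a plots" where
  "discrete_plots X n U p \<longleftrightarrow>
     openin (Euclidean_space n) U \<and>
     (\<forall>u\<in>U. \<exists>V. openin (Euclidean_space n) V \<and> u \<in> V \<and> V \<subseteq> U \<and> (\<exists>c\<in>X. \<forall>v\<in>V. p v = c))"

definition diff_induction :: "'a set \<Rightarrow> 'a plots \<Rightarrow> 'b set \<Rightarrow> 'b plots \<Rightarrow> ('a \<Rightarrow> 'b) \<Rightarrow> bool" where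
  "diff_induction X DX Y DY f \<longleftrightarrow>
     f \<in> X \<rightarrow> Y \<and> inj_on f X \<and>
     (\<forall>n U p. p \<in> U \<rightarrow> X \<longrightarrow> (DX n U p \<longleftrightarrow> DY n U (f \<circ> p)))"

definition diff_subduction :: "'a set \<Rightarrow> 'a plots \<Rightarrow> 'b set \<Rightarrow> 'b plots \<Rightarrow> ('a \<Rightarrow> 'b) \<Rightarrow> bool" where
  "diff_subduction X DX Y DY f \<longleftrightarrow>
     smooth_map X DX Y DY f \<and> f ` X = Y \<and>
     (\<forall>n U p. DY n U p \<longrightarrow>
        (\<forall>u\<in>U. \<exists>V q. u \<in> V \<and> V \<subseteq> U \<and> DX n V q \<and> (\<forall>v\<in>V. f (q v) = p v)))"

definition D_topology :: "'a set \<Rightarrow> 'a plots \<Rightarrow> 'a topology" where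
  "D_topology X D =
     topology (\<lambda>A. A \<subseteq> X \<and> (\<forall>n U p. D n U p \<longrightarrow> openin (Euclidean_space n) {u \<in> U. p u \<in> A}))"

lemma (in diffeological_space) openin_D_topology:
  "openin (D_topology X D) A \<longleftrightarrow>
     A \<subseteq> X \<and> (\<forall>n U p. D n U p \<longrightarrow> openin (Euclidean_space n) {u \<in> U. p u \<in> A})"
proof -
  have "istopology (\<lambda>A. A \<subseteq> X \<and> (\<forall>n U p. D n U p \<longrightarrow> openin (Euclidean_space n) {u \<in> U. p u \<in> A}))"
    unfolding istopology_def
  proof (intro conjI allI impI; (elim conjE)?)
    fix S T n U p
    assume "\<forall>n U p. D n U p \<longrightarrow> openin (Euclidean_space n) {u \<in> U. p u \<in> S}"
      and "\<forall>n U p. D n U p \<longrightarrow> openin (Euclidean_space n) {u \<in> U. p u \<in> T}" and "D n U p"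
    then have "openin (Euclidean_space n) ({u \<in> U. p u \<in> S} \<inter> {u \<in> U. p u \<in> T})"
      by blast
    then show "openin (Euclidean_space n) {u \<in> U. p u \<in> S \<inter> T}"
      by (rule back_subst) auto
  next
    fix K n U p
    assume "\<forall>S\<in>K. S \<subseteq> X \<and> (\<forall>n U p. D n U p \<longrightarrow> openin (Euclidean_space n) {u \<in> U. p u \<in> S})"
      and "D n U p"
    then have "openin (Euclidean_space n) (\<Union>S\<in>K. {u \<in> U. p u \<in> S})"
      by blast
    then show "openin (Euclidean_space n) {u \<in> U. p u \<in> \<Union>K}"
      by (rule back_subst) auto
  qed auto
  then show ?thesis
    unfolding D_topology_def by (simp add: topology_inverse')
qed


section \<open>Diffeological groups and the semidirect product with \<open>{\<plusminus>1}\<close>\<close>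

definition diffeological_group :: "('g, 'm) monoid_scheme \<Rightarrow> 'g plots \<Rightarrow> bool" where
  "diffeological_group G DG \<longleftrightarrow>
     group G \<and> diffeological_space (carrier G) DG \<and>
     smooth_map (carrier G \<times> carrier G) (prod_plots DG DG) (carrier G) DG (\<lambda>(a, b). a \<otimes>\<^bsub>G\<^esub> b) \<and>
     smooth_map (carrier G) DG (carrier G) DG (\<lambda>a. inv\<^bsub>G\<^esub> a)"

definition Z2 :: "int monoid" where
  "Z2 = \<lparr>carrier = {1, -1}, mult = (*), one = 1\<rparr>"

abbreviation Z2_plots :: "int plots" where
  "Z2_plots \<equiv> discrete_plots (carrier Z2)"

text \<open>
  As \<open>Z2\<close> is discrete, smoothness of the action map says that each \<open>\<sigma> \<epsilon>\<close> is smooth, hence a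
  diffeological automorphism (its inverse is \<open>\<sigma> \<epsilon>\<close> again).
\<close>

definition smooth_Z2_action :: "('g, 'm) monoid_scheme \<Rightarrow> 'g plots \<Rightarrow> (int \<Rightarrow> 'g \<Rightarrow> 'g) \<Rightarrow> bool" where
  "smooth_Z2_action G DG \<sigma> \<longleftrightarrow>
     \<sigma> \<in> hom Z2 (AutoGroup G) \<and>
     smooth_map (carrier Z2 \<times> carrier G) (prod_plots Z2_plots DG) (carrier G) DG (\<lambda>(\<epsilon>, a). \<sigma> \<epsilon> a)"

definition semidirect_Z2 :: "('g, 'm) monoid_scheme \<Rightarrow> (int \<Rightarrow> 'g \<Rightarrow> 'g) \<Rightarrow> ('g \<times> int) monoid" where
  "semidirect_Z2 G \<sigma> =
     \<lparr>carrier = carrier G \<times> carrier Z2,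
      mult = (\<lambda>(a, \<epsilon>) (b, \<delta>). (a \<otimes>\<^bsub>G\<^esub> \<sigma> \<epsilon> b, \<epsilon> \<otimes>\<^bsub>Z2\<^esub> \<delta>)),
      one = (\<one>\<^bsub>G\<^esub>, \<one>\<^bsub>Z2\<^esub>)\<rparr>"


section \<open>Principal bundles, trivializations, transition functions\<close>

text \<open>
  Principal bundles in the sense of Iglesias-Zemmour: a smooth right action whose orbits are the
  fibres of the subduction \<open>\<pi>\<close> and whose action map \<open>(p, h) \<mapsto> (p, p h)\<close> is an induction
  (injectivity of the latter is freeness of the action).
\<close>

definition principal_bundle ::
    "('h, 'm) monoid_scheme \<Rightarrow> 'h plots \<Rightarrow> 'p set \<Rightarrow> 'p plots \<Rightarrow> ('p \<Rightarrow> 'h \<Rightarrow> 'p) \<Rightarrow>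
     'x set \<Rightarrow> 'x plots \<Rightarrow> ('p \<Rightarrow> 'x) \<Rightarrow> bool" where
  "principal_bundle H DH P DP act X DX \<pi> \<longleftrightarrow>
     diffeological_group H DH \<and> diffeological_space P DP \<and> diffeological_space X DX \<and>
     smooth_map (P \<times> carrier H) (prod_plots DP DH) P DP (\<lambda>(p, h). act p h) \<and>
     (\<forall>p\<in>P. act p \<one>\<^bsub>H\<^esub> = p) \<and>
     (\<forall>p\<in>P. \<forall>h\<in>carrier H. \<forall>k\<in>carrier H. act (act p h) k = act p (h \<otimes>\<^bsub>H\<^esub> k)) \<and>
     diff_subduction P DP X DX \<pi> \<and>
     (\<forall>p\<in>P. \<forall>q\<in>P. \<pi> p = \<pi> q \<longleftrightarrow> (\<exists>h\<in>carrier H. q = act p h)) \<and>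
     diff_induction (P \<times> carrier H) (prod_plots DP DH) (P \<times> P) (prod_plots DP DP)
       (\<lambda>(p, h). (p, act p h))"

definition open_cover :: "'x set \<Rightarrow> 'x plots \<Rightarrow> 'i set \<Rightarrow> ('i \<Rightarrow> 'x set) \<Rightarrow> bool" where
  "open_cover X DX I U \<longleftrightarrow> (\<forall>i\<in>I. openin (D_topology X DX) (U i)) \<and> (\<Union>i\<in>I. U i) = X"

definition local_trivialization ::
    "('h, 'm) monoid_scheme \<Rightarrow> 'h plots \<Rightarrow> 'p set \<Rightarrow> 'p plots \<Rightarrow> ('p \<Rightarrow> 'h \<Rightarrow> 'p) \<Rightarrow>
     'x plots \<Rightarrow> ('p \<Rightarrow> 'x) \<Rightarrow> 'x set \<Rightarrow> ('x \<times> 'h \<Rightarrow> 'p) \<Rightarrow> bool" where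
  "local_trivialization H DH P DP act DX \<pi> A \<Phi> \<longleftrightarrow>
     diffeomorphism (A \<times> carrier H) (prod_plots (subset_plots DX A) DH)
       {p \<in> P. \<pi> p \<in> A} (subset_plots DP {p \<in> P. \<pi> p \<in> A}) \<Phi> \<and>
     (\<forall>x\<in>A. \<forall>h\<in>carrier H. \<pi> (\<Phi> (x, h)) = x) \<and>
     (\<forall>x\<in>A. \<forall>h\<in>carrier H. \<forall>k\<in>carrier H. \<Phi> (x, h \<otimes>\<^bsub>H\<^esub> k) = act (\<Phi> (x, h)) k)"

definition trivialized_over ::
    "('h, 'm) monoid_scheme \<Rightarrow> 'h plots \<Rightarrow> 'p set \<Rightarrow> 'p plots \<Rightarrow> ('p \<Rightarrow> 'h \<Rightarrow> 'p) \<Rightarrow>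
     'x set \<Rightarrow> 'x plots \<Rightarrow> ('p \<Rightarrow> 'x) \<Rightarrow> 'i set \<Rightarrow> ('i \<Rightarrow> 'x set) \<Rightarrow> ('i \<Rightarrow> 'x \<times> 'h \<Rightarrow> 'p) \<Rightarrow> bool" where
  "trivialized_over H DH P DP act X DX \<pi> I U \<Phi> \<longleftrightarrow>
     open_cover X DX I U \<and> (\<forall>i\<in>I. local_trivialization H DH P DP act DX \<pi> (U i) (\<Phi> i))"

definition local_section :: "('h, 'm) monoid_scheme \<Rightarrow> ('x \<times> 'h \<Rightarrow> 'p) \<Rightarrow> 'x \<Rightarrow> 'p" where
  "local_section H \<Phi> x = \<Phi> (x, \<one>\<^bsub>H\<^esub>)"

definition transition_functions ::
    "('h, 'm) monoid_scheme \<Rightarrow> 'h plots \<Rightarrow> ('p \<Rightarrow> 'h \<Rightarrow> 'p) \<Rightarrow> 'x plots \<Rightarrow>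
     'i set \<Rightarrow> ('i \<Rightarrow> 'x set) \<Rightarrow> ('i \<Rightarrow> 'x \<Rightarrow> 'p) \<Rightarrow> ('i \<Rightarrow> 'i \<Rightarrow> 'x \<Rightarrow> 'h) \<Rightarrow> bool" where
  "transition_functions H DH act DX I U s h \<longleftrightarrow>
     (\<forall>i\<in>I. \<forall>j\<in>I.
        smooth_map (U i \<inter> U j) (subset_plots DX (U i \<inter> U j)) (carrier H) DH (h i j) \<and>
        (\<forall>x\<in>U i \<inter> U j. s j x = act (s i x) (h i j x)))"


section \<open>Cech cohomology with coefficients in \<open>{\<plusminus>1}\<close>\<close>

definition locally_constant_Z2 :: "'x set \<Rightarrow> 'x plots \<Rightarrow> 'x set \<Rightarrow> ('x \<Rightarrow> int) \<Rightarrow> bool" where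
  "locally_constant_Z2 X DX A f \<longleftrightarrow>
     continuous_map (subtopology (D_topology X DX) A) (discrete_topology (carrier Z2)) f"

definition cech_cocycle ::
    "'x set \<Rightarrow> 'x plots \<Rightarrow> 'i set \<Rightarrow> ('i \<Rightarrow> 'x set) \<Rightarrow> ('i \<Rightarrow> 'i \<Rightarrow> 'x \<Rightarrow> int) \<Rightarrow> bool" where
  "cech_cocycle X DX I U \<epsilon> \<longleftrightarrow>
     (\<forall>i\<in>I. \<forall>j\<in>I. locally_constant_Z2 X DX (U i \<inter> U j) (\<epsilon> i j)) \<and>
     (\<forall>i\<in>I. \<forall>j\<in>I. \<forall>k\<in>I. \<forall>x\<in>U i \<inter> U j \<inter> U k. \<epsilon> i j x \<otimes>\<^bsub>Z2\<^esub> \<epsilon> j k x = \<epsilon> i k x)"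

type_synonym ('i, 'x) cech_datum = "'i set \<times> ('i \<Rightarrow> 'x set) \<times> ('i \<Rightarrow> 'i \<Rightarrow> 'x \<Rightarrow> int)"

definition cech_cocycles :: "'x set \<Rightarrow> 'x plots \<Rightarrow> ('i, 'x) cech_datum set" where
  "cech_cocycles X DX = {(I, U, \<epsilon>). open_cover X DX I U \<and> cech_cocycle X DX I U \<epsilon>}"

text \<open>
  Equality in the colimit over all open covers: on some common refinement the two cocycles differ
  by a coboundary. The refining cover \<open>\<W>\<close> is indexed by its own members; this is no restriction,
  since from an arbitrary indexed refinement one may keep one index for each member.
\<close>

definition cech_equiv ::
    "'x set \<Rightarrow> 'x plots \<Rightarrow> ('i, 'x) cech_datum \<Rightarrow> ('j, 'x) cech_datum \<Rightarrow> bool" where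
  "cech_equiv X DX = (\<lambda>(I, U, \<epsilon>) (J, V, \<eta>).
     \<exists>\<W> r t c. open_cover X DX \<W> (\<lambda>W. W) \<and>
       (\<forall>W\<in>\<W>. r W \<in> I \<and> W \<subseteq> U (r W) \<and> t W \<in> J \<and> W \<subseteq> V (t W) \<and>
               locally_constant_Z2 X DX W (c W)) \<and>
       (\<forall>W\<in>\<W>. \<forall>W'\<in>\<W>. \<forall>x\<in>W \<inter> W'.
          c W x \<otimes>\<^bsub>Z2\<^esub> \<eta> (t W) (t W') x = \<epsilon> (r W) (r W') x \<otimes>\<^bsub>Z2\<^esub> c W' x))"

text \<open>
  To stay within one type, \<open>H^1(X; Z2)\<close> is the quotient of the cocycles over covers indexed by
  sets of subsets of \<open>X\<close>; every indexed cover is refined by one of these. A cocycle over a cover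
  with any other index type determines the class of all such cocycles equivalent to it.
\<close>

definition cech_H1 :: "'x set \<Rightarrow> 'x plots \<Rightarrow> ('x set, 'x) cech_datum set set" where
  "cech_H1 X DX =
     cech_cocycles X DX //
       {(a, b). a \<in> cech_cocycles X DX \<and> b \<in> cech_cocycles X DX \<and> cech_equiv X DX a b}"

definition cech_class :: "'x set \<Rightarrow> 'x plots \<Rightarrow> ('i, 'x) cech_datum \<Rightarrow> ('x set, 'x) cech_datum set" where
  "cech_class X DX a = {b \<in> cech_cocycles X DX. cech_equiv X DX a b}"

text \<open>
  The class \<open>\<alpha>(P)\<close> of a bundle whose structure group is a semidirect product with \<open>Z2\<close>: the
  common class of the \<open>Z2\<close>-components of the transition functions of all trivializations. It is
  meaningful only if \<open>P\<close> can be trivialized over some D-open cover.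
\<close>

definition alpha_class ::
    "('g \<times> int, 'm) monoid_scheme \<Rightarrow> ('g \<times> int) plots \<Rightarrow> 'p set \<Rightarrow> 'p plots \<Rightarrow>
     ('p \<Rightarrow> 'g \<times> int \<Rightarrow> 'p) \<Rightarrow> 'x set \<Rightarrow> 'x plots \<Rightarrow> ('p \<Rightarrow> 'x) \<Rightarrow> ('x set, 'x) cech_datum set" where
  "alpha_class H DH P DP act X DX \<pi> =
     (THE a. \<exists>(I :: 'x set set) U \<Phi> h.
        trivialized_over H DH P DP act X DX \<pi> I U \<Phi> \<and>
        transition_functions H DH act DX I U (\<lambda>i. local_section H (\<Phi> i)) h \<and>
        a = cech_class X DX (I, U, \<lambda>i j x. snd (h i j x)))"

text \<open>\<open>G\<close>-valued cocycles twisted by the local system which the \<open>Z2\<close>-cocycle \<open>\<epsilon>\<close> defines.\<close>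

definition twisted_cocycle ::
    "('g, 'm) monoid_scheme \<Rightarrow> 'g plots \<Rightarrow> (int \<Rightarrow> 'g \<Rightarrow> 'g) \<Rightarrow> 'x set \<Rightarrow> 'x plots \<Rightarrow>
     'i set \<Rightarrow> ('i \<Rightarrow> 'x set) \<Rightarrow> ('i \<Rightarrow> 'i \<Rightarrow> 'x \<Rightarrow> int) \<Rightarrow> ('i \<Rightarrow> 'i \<Rightarrow> 'x \<Rightarrow> 'g) \<Rightarrow> bool" where
  "twisted_cocycle G DG \<sigma> X DX I U \<epsilon> g \<longleftrightarrow>
     cech_cocycle X DX I U \<epsilon> \<and>
     (\<forall>i\<in>I. \<forall>j\<in>I.
        smooth_map (U i \<inter> U j) (subset_plots DX (U i \<inter> U j)) (carrier G) DG (g i j)) \<and>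
     (\<forall>i\<in>I. \<forall>j\<in>I. \<forall>k\<in>I. \<forall>x\<in>U i \<inter> U j \<inter> U k.
        g i j x \<otimes>\<^bsub>G\<^esub> \<sigma> (\<epsilon> i j x) (g j k x) = g i k x)"

end

theory Submission
  imports Defs
begin

text \<open>
  The transition functions \<open>h i j\<close> of a principal bundle form a nonabelian cocycle, because the
  action is free: \<open>transition_functions_cocycle\<close>. In the semidirect product this single relation has
  two components. The second is the cocycle relation of the signs \<open>\<epsilon> i j\<close>; the first, in which the
  sign of the left factor acts on the right factor, is the twisted relation of the \<open>g i j\<close>. That the
  signs are locally constant holds because a smooth map on a D-open set into a discrete space is
  continuous for the D-topology: \<open>smooth_imp_locally_constant_Z2\<close>.

  The class of the signs is \<open>\<alpha>(P)\<close> because it does not depend on the trivialization. The sections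
  \<open>s i\<close>, \<open>s' j\<close> of two trivializations satisfy \<open>s' j = s i \<cdot> a i j\<close> on \<open>U i \<inter> V j\<close> for a
  unique \<open>a i j\<close>, which is smooth since the action map is an induction. Comparing over two pairs of
  indices gives \<open>a i j \<cdot> h' j l = h i k \<cdot> a k l\<close>, and the projection to the signs makes of this a
  coboundary on the common refinement \<open>U i \<inter> V j\<close>: \<open>sign_cech_equiv\<close>.

  Classes are made of cocycles over covers indexed by sets of subsets of \<open>X\<close>, whereas the given
  cover has an arbitrary index type. The passage between the two, indexing a cover by its own
  members, rests on the symmetry and transitivity of \<open>cech_equiv\<close> across index types.
\<close>

section \<open>Maps into the discrete group\<close>

lemma continuous_map_coordinate:
  "continuous_map (subtopology (Euclidean_space n) U) euclideanreal (\<lambda>x. x i)"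
  unfolding Euclidean_space_def
  by (intro continuous_map_from_subtopology continuous_map_product_projection) simp

lemma Ck_on_const: "Ck_on k n U (\<lambda>_. c)"
proof (induction k arbitrary: c)
  case (Suc k)
  have "\<exists>f'. (\<forall>x\<in>U. ((\<lambda>t. c) has_real_derivative f' x) (at (x i))) \<and> Ck_on k n U f'" for i
    by (rule exI[of _ "\<lambda>_. 0"]) (use Suc in auto)
  then show ?case by simp
qed simp

lemma Ck_on_coordinate: "Ck_on k n U (\<lambda>x. x i)"
proof (cases k)
  case 0
  then show ?thesis by (simp add: continuous_map_coordinate)
next
  case (Suc l)
  have "\<exists>f'. (\<forall>x\<in>U. ((\<lambda>t. (x(j := t)) i) has_real_derivative f' x) (at (x j))) \<and> Ck_on l n U f'" for j
    by (rule exI[of _ "\<lambda>_. if i = j then 1 else 0"]) (auto simp: Ck_on_const)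
  then show ?thesis using Suc by (simp add: continuous_map_coordinate)
qed

text \<open>Restriction is composition with the inclusion, whose coordinates are smooth.\<close>
lemma (in diffeological_space) plot_restrict:
  assumes "D n U p" "openin (Euclidean_space n) V" "V \<subseteq> U"
  shows "D n V p"
proof -
  have "smooth_euclidean n V n U (\<lambda>x. x)"
    using assms(3) by (auto simp: smooth_euclidean_def Ck_on_coordinate)
  from plot_compose[OF assms(1,2) this] show ?thesis by (simp add: comp_def)
qed

lemma openin_discrete_plot_vimage:
  assumes "discrete_plots Y n U p"
  shows "openin (Euclidean_space n) {u \<in> U. p u \<in> S}"
proof (subst openin_subopen, intro ballI)
  fix u assume u: "u \<in> {u \<in> U. p u \<in> S}"
  with assms obtain V c where "openin (Euclidean_space n) V" "u \<in> V" "V \<subseteq> U" "\<forall>v\<in>V. p v = c"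
    unfolding discrete_plots_def by blast
  with u show "\<exists>T. openin (Euclidean_space n) T \<and> u \<in> T \<and> T \<subseteq> {u \<in> U. p u \<in> S}"
    by (intro exI[of _ V]) auto
qed

text \<open>
  Openness in the D-topology is tested on plots of all of \<open>X\<close>, but \<open>f\<close> can only be composed with
  plots in \<open>A\<close>. As \<open>A\<close> is open, a plot of \<open>X\<close> restricts to a plot in \<open>A\<close> on the open preimage of \<open>A\<close>;
  its composite with \<open>f\<close> is then locally constant.
\<close>
lemma (in diffeological_space) smooth_imp_locally_constant_Z2:
  assumes A: "openin (D_topology X D) A"
    and f: "smooth_map A (subset_plots D A) (carrier Z2) Z2_plots f"
  shows "locally_constant_Z2 X D A f"
proof -
  have sub: "A \<subseteq> X" using A by (simp add: openin_D_topology)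
  have "openin (D_topology X D) {x \<in> A. f x \<in> S}" for S
    unfolding openin_D_topology
  proof (intro conjI allI impI)
    show "{x \<in> A. f x \<in> S} \<subseteq> X" using sub by blast
    fix n U p assume p: "D n U p"
    let ?W = "{u \<in> U. p u \<in> A}"
    have "openin (Euclidean_space n) ?W" using A p by (simp add: openin_D_topology)
    with p have "subset_plots D A n ?W p"
      unfolding subset_plots_def by (auto intro: plot_restrict)
    with f have "Z2_plots n ?W (f \<circ> p)" unfolding smooth_map_def by blast
    from openin_discrete_plot_vimage[OF this, of S]
    show "openin (Euclidean_space n) {u \<in> U. p u \<in> {x \<in> A. f x \<in> S}}"
      by (rule back_subst) auto
  qed
  then have "openin (subtopology (D_topology X D) A) {x \<in> A. f x \<in> S}" for S
    by (metis (no_types, lifting) A openin_open_subtopology mem_Collect_eq subsetI)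
  moreover have "topspace (subtopology (D_topology X D) A) = A"
    using A by (simp add: openin_subset inf_absorb2)
  moreover have "f \<in> A \<rightarrow> carrier Z2" using f by (simp add: smooth_map_def)
  ultimately show ?thesis
    unfolding locally_constant_Z2_def continuous_map_def by auto
qed

lemma locally_constant_Z2_const:
  "c \<in> carrier Z2 \<Longrightarrow> locally_constant_Z2 X DX A (\<lambda>_. c)"
  by (simp add: locally_constant_Z2_def)

lemma locally_constant_Z2_subset:
  "locally_constant_Z2 X DX A f \<Longrightarrow> B \<subseteq> A \<Longrightarrow> locally_constant_Z2 X DX B f"
  unfolding locally_constant_Z2_def by (rule continuous_map_from_subtopology_mono)

lemma Z2_mult: "a \<otimes>\<^bsub>Z2\<^esub> b = a * b" by (simp add: Z2_def)

lemma locally_constant_Z2_mult: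
  assumes "locally_constant_Z2 X DX A f" "locally_constant_Z2 X DX A g"
  shows "locally_constant_Z2 X DX A (\<lambda>x. f x \<otimes>\<^bsub>Z2\<^esub> g x)"
proof -
  have "continuous_map (subtopology (D_topology X DX) A)
          (discrete_topology (carrier Z2 \<times> carrier Z2)) (\<lambda>x. (f x, g x))"
    using assms unfolding locally_constant_Z2_def prod_topology_discrete_topology
    by (rule continuous_map_pairedI)
  moreover have "continuous_map (discrete_topology (carrier Z2 \<times> carrier Z2))
          (discrete_topology (carrier Z2)) (\<lambda>(a, b). a \<otimes>\<^bsub>Z2\<^esub> b)"
    by (auto simp: Z2_def)
  ultimately have "continuous_map (subtopology (D_topology X DX) A) (discrete_topology (carrier Z2))
      ((\<lambda>(a, b). a \<otimes>\<^bsub>Z2\<^esub> b) \<circ> (\<lambda>x. (f x, g x)))"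
    by (rule continuous_map_compose)
  then show ?thesis by (simp add: locally_constant_Z2_def comp_def)
qed

lemma locally_constant_Z2_square:
  assumes "locally_constant_Z2 X DX A f" "openin (D_topology X DX) A" "x \<in> A"
  shows "f x * f x = 1"
proof -
  have "x \<in> topspace (subtopology (D_topology X DX) A)"
    using assms(2,3) openin_subset by fastforce
  with assms(1) have "f x \<in> carrier Z2"
    unfolding locally_constant_Z2_def continuous_map_def by auto
  then show ?thesis by (auto simp: Z2_def)
qed

section \<open>Equivalence of Cech cocycles\<close>

lemma open_cover_openin: "open_cover X DX I U \<Longrightarrow> i \<in> I \<Longrightarrow> openin (D_topology X DX) (U i)"
  by (simp add: open_cover_def)

lemma cech_cocycle_mult:
  "\<lbrakk>cech_cocycle X DX I U \<epsilon>; i \<in> I; j \<in> I; k \<in> I; x \<in> U i; x \<in> U j; x \<in> U k\<rbrakk>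
    \<Longrightarrow> \<epsilon> i j x * \<epsilon> j k x = \<epsilon> i k x"
  by (auto simp: cech_cocycle_def Z2_mult)

lemma open_cover_common_refinement:
  assumes "open_cover X DX I U" "open_cover X DX J V"
  shows "open_cover X DX (I \<times> J) (\<lambda>(i, j). U i \<inter> V j)"
  unfolding open_cover_def
proof
  show "\<forall>k\<in>I \<times> J. openin (D_topology X DX) (case k of (i, j) \<Rightarrow> U i \<inter> V j)"
    using assms by (auto simp: open_cover_def)
  have "(\<Union>k\<in>I \<times> J. case k of (i, j) \<Rightarrow> U i \<inter> V j) = (\<Union>i\<in>I. U i) \<inter> (\<Union>j\<in>J. V j)" by auto
  then show "(\<Union>k\<in>I \<times> J. case k of (i, j) \<Rightarrow> U i \<inter> V j) = X"
    using assms by (simp add: open_cover_def)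
qed

lemma open_cover_image: "open_cover X DX (U ` I) (\<lambda>W. W) \<longleftrightarrow> open_cover X DX I U"
  by (auto simp: open_cover_def)

text \<open>
  A refinement may carry any index set: choosing one index for each member of the cover gives a
  refinement indexed by its own members, and the relation between the two cocycles, being required
  of all pairs of indices, survives the choice.
\<close>
lemma cech_equivI:
  assumes cover: "open_cover X DX K W"
    and ref: "\<And>k. k \<in> K \<Longrightarrow> r k \<in> I \<and> W k \<subseteq> U (r k) \<and> t k \<in> J \<and> W k \<subseteq> V (t k)"
    and lc: "\<And>k. k \<in> K \<Longrightarrow> locally_constant_Z2 X DX (W k) (c k)"
    and eq: "\<And>k l x. \<lbrakk>k \<in> K; l \<in> K; x \<in> W k; x \<in> W l\<rbrakk>
               \<Longrightarrow> c k x * \<eta> (t k) (t l) x = \<epsilon> (r k) (r l) x * c l x"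
  shows "cech_equiv X DX (I, U, \<epsilon>) (J, V, \<eta>)"
proof -
  define m where "m = inv_into K W"
  have m: "m w \<in> K" "W (m w) = w" if "w \<in> W ` K" for w
    using that unfolding m_def by (simp_all add: inv_into_into f_inv_into_f)
  show ?thesis
    unfolding cech_equiv_def prod.case Z2_mult
  proof (intro exI conjI ballI)
    show "open_cover X DX (W ` K) (\<lambda>w. w)" using cover by (simp add: open_cover_image)
    fix w assume w: "w \<in> W ` K"
    show "(r \<circ> m) w \<in> I" "w \<subseteq> U ((r \<circ> m) w)" "(t \<circ> m) w \<in> J" "w \<subseteq> V ((t \<circ> m) w)"
      "locally_constant_Z2 X DX w ((c \<circ> m) w)"
      using ref[OF m(1)[OF w]] lc[OF m(1)[OF w]] m(2)[OF w] by auto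
    fix w' x assume w': "w' \<in> W ` K" and x: "x \<in> w \<inter> w'"
    show "(c \<circ> m) w x * \<eta> ((t \<circ> m) w) ((t \<circ> m) w') x = \<epsilon> ((r \<circ> m) w) ((r \<circ> m) w') x * (c \<circ> m) w' x"
      using eq[OF m(1)[OF w] m(1)[OF w'], of x] m(2)[OF w] m(2)[OF w'] x by auto
  qed
qed

lemma cech_equivD:
  assumes "cech_equiv X DX (I, U, \<epsilon>) (J, V, \<eta>)"
  shows "\<exists>\<W> r t c. open_cover X DX \<W> (\<lambda>W. W) \<and>
    (\<forall>W\<in>\<W>. r W \<in> I \<and> W \<subseteq> U (r W) \<and> t W \<in> J \<and> W \<subseteq> V (t W)) \<and>
    (\<forall>W\<in>\<W>. locally_constant_Z2 X DX W (c W)) \<and>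
    (\<forall>W\<in>\<W>. \<forall>W'\<in>\<W>. \<forall>x. x \<in> W \<longrightarrow> x \<in> W' \<longrightarrow>
       c W x * \<eta> (t W) (t W') x = \<epsilon> (r W) (r W') x * c W' x)"
proof -
  from assms[unfolded cech_equiv_def prod.case Z2_mult] obtain \<W> r t c
    where cover: "open_cover X DX \<W> (\<lambda>W. W)"
      and ref: "\<forall>W\<in>\<W>. r W \<in> I \<and> W \<subseteq> U (r W) \<and> t W \<in> J \<and> W \<subseteq> V (t W) \<and>
                  locally_constant_Z2 X DX W (c W)"
      and eq: "\<forall>W\<in>\<W>. \<forall>W'\<in>\<W>. \<forall>x\<in>W \<inter> W'.
                 c W x * \<eta> (t W) (t W') x = \<epsilon> (r W) (r W') x * c W' x"
    by (elim exE conjE) (rule that)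
  show ?thesis
  proof (intro exI conjI)
    show "open_cover X DX \<W> (\<lambda>W. W)" by (rule cover)
    show "\<forall>W\<in>\<W>. r W \<in> I \<and> W \<subseteq> U (r W) \<and> t W \<in> J \<and> W \<subseteq> V (t W)"
      and "\<forall>W\<in>\<W>. locally_constant_Z2 X DX W (c W)" using ref by blast+
    show "\<forall>W\<in>\<W>. \<forall>W'\<in>\<W>. \<forall>x. x \<in> W \<longrightarrow> x \<in> W' \<longrightarrow>
       c W x * \<eta> (t W) (t W') x = \<epsilon> (r W) (r W') x * c W' x"
      using eq by blast
  qed
qed

text \<open>The same cochain serves in both directions, since each sign is its own inverse.\<close>
lemma cech_equiv_sym:
  assumes "cech_equiv X DX (I, U, \<epsilon>) (J, V, \<eta>)"
  shows "cech_equiv X DX (J, V, \<eta>) (I, U, \<epsilon>)"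
proof -
  from cech_equivD[OF assms] obtain \<W> r t c where W: "open_cover X DX \<W> (\<lambda>W. W)"
    and balls: "\<forall>W\<in>\<W>. r W \<in> I \<and> W \<subseteq> U (r W) \<and> t W \<in> J \<and> W \<subseteq> V (t W)"
      "\<forall>W\<in>\<W>. locally_constant_Z2 X DX W (c W)"
      "\<forall>W\<in>\<W>. \<forall>W'\<in>\<W>. \<forall>x. x \<in> W \<longrightarrow> x \<in> W' \<longrightarrow>
         c W x * \<eta> (t W) (t W') x = \<epsilon> (r W) (r W') x * c W' x"
    by (elim exE conjE) (rule that)
  note ref = balls(1)[rule_format] and lc = balls(2)[rule_format] and eq = balls(3)[rule_format]
  show ?thesis
  proof (rule cech_equivI[OF W, where r = t and t = r and c = c])
    fix k l x assume *: "k \<in> \<W>" "l \<in> \<W>" "x \<in> k" "x \<in> l"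
    have "c k x * c k x = 1" "c l x * c l x = 1"
      using * lc open_cover_openin[OF W] by (blast intro: locally_constant_Z2_square)+
    then have "c k x * \<epsilon> (r k) (r l) x = c k x * (\<epsilon> (r k) (r l) x * c l x) * c l x"
      by (simp add: mult.assoc)
    also have "\<dots> = (c k x * c k x) * \<eta> (t k) (t l) x * c l x"
      by (simp add: eq[OF *, symmetric] mult.assoc)
    also have "\<dots> = \<eta> (t k) (t l) x * c l x"
      using \<open>c k x * c k x = 1\<close> by simp
    finally show "c k x * \<epsilon> (r k) (r l) x = \<eta> (t k) (t l) x * c l x" .
  qed (simp_all add: ref lc)
qed

text \<open>
  On the intersection of a member \<open>W\<close> of the first refinement and a member \<open>W'\<close> of the second, the
  middle cocycle is read off over two different indices \<open>t W\<close> and \<open>r' W'\<close>. The cochain that relates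
  the outer cocycles is therefore not just \<open>c W * c' W'\<close>: the transition \<open>\<eta> (t W) (r' W')\<close> has to be
  inserted, and the cocycle relation of \<open>\<eta>\<close> makes it telescope.
\<close>
lemma cech_equiv_trans:
  assumes "cech_equiv X DX (I, U, \<epsilon>) (J, V, \<eta>)" "cech_equiv X DX (J, V, \<eta>) (K, Z, \<zeta>)"
    and \<eta>: "cech_cocycle X DX J V \<eta>"
  shows "cech_equiv X DX (I, U, \<epsilon>) (K, Z, \<zeta>)"
proof -
  from cech_equivD[OF assms(1)] obtain \<W> r t c where W: "open_cover X DX \<W> (\<lambda>W. W)"
    and balls: "\<forall>W\<in>\<W>. r W \<in> I \<and> W \<subseteq> U (r W) \<and> t W \<in> J \<and> W \<subseteq> V (t W)"
      "\<forall>W\<in>\<W>. locally_constant_Z2 X DX W (c W)"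
      "\<forall>W\<in>\<W>. \<forall>W'\<in>\<W>. \<forall>x. x \<in> W \<longrightarrow> x \<in> W' \<longrightarrow>
         c W x * \<eta> (t W) (t W') x = \<epsilon> (r W) (r W') x * c W' x"
    by (elim exE conjE) (rule that)
  note ref = balls(1)[rule_format] and lc = balls(2)[rule_format] and eq = balls(3)[rule_format]
  from cech_equivD[OF assms(2)] obtain \<W>' r' t' c' where W': "open_cover X DX \<W>' (\<lambda>W. W)"
    and balls': "\<forall>W\<in>\<W>'. r' W \<in> J \<and> W \<subseteq> V (r' W) \<and> t' W \<in> K \<and> W \<subseteq> Z (t' W)"
      "\<forall>W\<in>\<W>'. locally_constant_Z2 X DX W (c' W)"
      "\<forall>W\<in>\<W>'. \<forall>W'\<in>\<W>'. \<forall>x. x \<in> W \<longrightarrow> x \<in> W' \<longrightarrow>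
         c' W x * \<zeta> (t' W) (t' W') x = \<eta> (r' W) (r' W') x * c' W' x"
    by (elim exE conjE) (rule that)
  note ref' = balls'(1)[rule_format] and lc' = balls'(2)[rule_format] and eq' = balls'(3)[rule_format]
  define d where "d = (\<lambda>(w, w') x. (c w x \<otimes>\<^bsub>Z2\<^esub> \<eta> (t w) (r' w') x) \<otimes>\<^bsub>Z2\<^esub> c' w' x)"
  show ?thesis
  proof (rule cech_equivI[OF open_cover_common_refinement[OF W W'],
        where r = "\<lambda>(w, w'). r w" and t = "\<lambda>(w, w'). t' w'" and c = d], goal_cases)
    case (1 k)
    then obtain w w' where k: "k = (w, w')" "w \<in> \<W>" "w' \<in> \<W>'" by blast
    show ?case
      unfolding k(1) prod.case using ref[OF k(2)] ref'[OF k(3)] by (simp add: le_infI1 le_infI2)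
  next
    case (2 k)
    then obtain w w' where k: "k = (w, w')" "w \<in> \<W>" "w' \<in> \<W>'" by blast
    have "locally_constant_Z2 X DX (V (t w) \<inter> V (r' w')) (\<eta> (t w) (r' w'))"
      using \<eta> ref[OF k(2)] ref'[OF k(3)] by (simp add: cech_cocycle_def)
    then have "locally_constant_Z2 X DX (w \<inter> w') (\<eta> (t w) (r' w'))"
      by (rule locally_constant_Z2_subset) (use ref[OF k(2)] ref'[OF k(3)] in blast)
    then show ?case
      unfolding k(1) d_def prod.case
      by (intro locally_constant_Z2_mult locally_constant_Z2_subset[OF lc[OF k(2)]]
          locally_constant_Z2_subset[OF lc'[OF k(3)]] Int_lower1 Int_lower2)
  next
    case (3 k l x)
    then obtain w w' v v' where k: "k = (w, w')" "w \<in> \<W>" "w' \<in> \<W>'" "l = (v, v')" "v \<in> \<W>" "v' \<in> \<W>'"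
      and x: "x \<in> w" "x \<in> w'" "x \<in> v" "x \<in> v'" by auto
    have \<eta>1: "\<eta> (t w) (r' w') x * \<eta> (r' w') (r' v') x = \<eta> (t w) (r' v') x"
      using ref[OF k(2)] ref'[OF k(3)] ref'[OF k(6)] x by (intro cech_cocycle_mult[OF \<eta>]) auto
    have \<eta>2: "\<eta> (t w) (t v) x * \<eta> (t v) (r' v') x = \<eta> (t w) (r' v') x"
      using ref[OF k(2)] ref[OF k(5)] ref'[OF k(6)] x by (intro cech_cocycle_mult[OF \<eta>]) auto
    have "c w x * \<eta> (t w) (r' w') x * (c' w' x * \<zeta> (t' w') (t' v') x)
        = c w x * (\<eta> (t w) (r' w') x * \<eta> (r' w') (r' v') x) * c' v' x"
      unfolding eq'[OF k(3,6) x(2,4)] by (simp only: mult.assoc)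
    also have "\<dots> = (c w x * \<eta> (t w) (t v) x) * \<eta> (t v) (r' v') x * c' v' x"
      unfolding \<eta>1 \<eta>2[symmetric] by (simp only: mult.assoc)
    also have "\<dots> = \<epsilon> (r w) (r v) x * (c v x * \<eta> (t v) (r' v') x * c' v' x)"
      unfolding eq[OF k(2,5) x(1,3)] by (simp only: mult.assoc)
    finally show ?case
      by (simp add: k d_def Z2_mult mult.assoc)
  qed
qed

lemma cech_class_eqI:
  fixes X :: "'x set"
  assumes "cech_equiv X DX (I, U, \<epsilon>) (J, V, \<eta>)"
    and "cech_cocycle X DX I U \<epsilon>" "cech_cocycle X DX J V \<eta>"
  shows "cech_class X DX (I, U, \<epsilon>) = cech_class X DX (J, V, \<eta>)"
proof -
  have "cech_equiv X DX (I, U, \<epsilon>) b \<longleftrightarrow> cech_equiv X DX (J, V, \<eta>) b"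
    for b :: "('x set, 'x) cech_datum"
    using cech_equiv_trans[OF assms(1) _ assms(3)]
      cech_equiv_trans[OF cech_equiv_sym[OF assms(1)] _ assms(2)] by (cases b) blast
  then show ?thesis unfolding cech_class_def by (simp only:)
qed

lemma cech_cocycle_reindex:
  assumes "cech_cocycle X DX I U \<epsilon>" "\<And>k. k \<in> K \<Longrightarrow> m k \<in> I \<and> U (m k) = W k"
  shows "cech_cocycle X DX K W (\<lambda>k l. \<epsilon> (m k) (m l))"
  unfolding cech_cocycle_def
proof (intro conjI ballI)
  fix k l assume k: "k \<in> K" and l: "l \<in> K"
  have "locally_constant_Z2 X DX (U (m k) \<inter> U (m l)) (\<epsilon> (m k) (m l))"
    using assms(1) assms(2)[OF k] assms(2)[OF l] unfolding cech_cocycle_def by blast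
  then show "locally_constant_Z2 X DX (W k \<inter> W l) (\<epsilon> (m k) (m l))"
    by (simp only: assms(2)[OF k] assms(2)[OF l])
next
  fix k l n x assume k: "k \<in> K" and l: "l \<in> K" and n: "n \<in> K" and x: "x \<in> W k \<inter> W l \<inter> W n"
  show "\<epsilon> (m k) (m l) x \<otimes>\<^bsub>Z2\<^esub> \<epsilon> (m l) (m n) x = \<epsilon> (m k) (m n) x"
    unfolding Z2_mult
    by (rule cech_cocycle_mult[OF assms(1)]) (use assms(2)[OF k] assms(2)[OF l] assms(2)[OF n] x in auto)
qed

lemma cech_equiv_reindex:
  assumes "cech_cocycle X DX I U \<epsilon>" "\<And>k. k \<in> K \<Longrightarrow> m k \<in> I \<and> U (m k) = W k"
    and "open_cover X DX K W"
  shows "cech_equiv X DX (I, U, \<epsilon>) (K, W, \<lambda>k l. \<epsilon> (m k) (m l))"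
  by (rule cech_equivI[OF assms(3), where r = m and t = "\<lambda>k. k" and c = "\<lambda>_ _. 1"])
    (simp_all add: assms(2) locally_constant_Z2_const Z2_def)

text \<open>
  The classes that make up \<open>H\<^sup>1\<close> are classes of cocycles over covers indexed by sets of subsets
  of \<open>X\<close>. Any cocycle is equivalent to one of these: index its cover by its own members.
\<close>
lemma cech_class_in_H1:
  fixes I :: "'i set" and X :: "'x set"
  assumes cover: "open_cover X DX I U" and coc: "cech_cocycle X DX I U \<epsilon>"
  shows "cech_class X DX (I, U, \<epsilon>) \<in> cech_H1 X DX"
proof -
  define m where "m = inv_into I U"
  define b :: "('x set, 'x) cech_datum" where "b = (U ` I, \<lambda>W. W, \<lambda>k l. \<epsilon> (m k) (m l))"
  have m: "m W \<in> I \<and> U (m W) = W" if "W \<in> U ` I" for W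
    using that unfolding m_def by (simp_all add: inv_into_into f_inv_into_f)
  have cover': "open_cover X DX (U ` I) (\<lambda>W. W)" using cover by (simp add: open_cover_image)
  note coc' = cech_cocycle_reindex[OF coc, of "U ` I" m "\<lambda>W. W", OF m]
  have b: "b \<in> cech_cocycles X DX" using coc' cover' by (simp add: b_def cech_cocycles_def)
  have "cech_class X DX (I, U, \<epsilon>) = cech_class X DX b"
    unfolding b_def using coc coc' cech_equiv_reindex[OF coc m cover'] by (intro cech_class_eqI)
  also have "\<dots> = {(a, b). a \<in> cech_cocycles X DX \<and> b \<in> cech_cocycles X DX \<and> cech_equiv X DX a b} `` {b}"
    using b by (auto simp: cech_class_def)
  finally show ?thesis unfolding cech_H1_def using quotientI[OF b] by (simp only:)
qed

section \<open>Transition functions of principal bundles\<close>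

lemma principal_bundleD:
  assumes "principal_bundle H DH P DP act X DX \<pi>"
  shows "group H" "diffeological_space (carrier H) DH" "diffeological_space P DP"
    "diffeological_space X DX"
    and "\<lbrakk>p \<in> P; a \<in> carrier H\<rbrakk> \<Longrightarrow> act p a \<in> P"
    and "\<lbrakk>p \<in> P; a \<in> carrier H; b \<in> carrier H\<rbrakk> \<Longrightarrow> act (act p a) b = act p (a \<otimes>\<^bsub>H\<^esub> b)"
    and "\<lbrakk>p \<in> P; a \<in> carrier H; b \<in> carrier H; act p a = act p b\<rbrakk> \<Longrightarrow> a = b"
    and "\<lbrakk>p \<in> P; q \<in> P\<rbrakk> \<Longrightarrow> \<pi> p = \<pi> q \<longleftrightarrow> (\<exists>a\<in>carrier H. q = act p a)"
proof -
  from assms[unfolded principal_bundle_def] obtain grp: "diffeological_group H DH"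
    and act: "smooth_map (P \<times> carrier H) (prod_plots DP DH) P DP (\<lambda>(p, h). act p h)"
    and mult: "\<forall>p\<in>P. \<forall>h\<in>carrier H. \<forall>k\<in>carrier H. act (act p h) k = act p (h \<otimes>\<^bsub>H\<^esub> k)"
    and fibres: "\<forall>p\<in>P. \<forall>q\<in>P. \<pi> p = \<pi> q \<longleftrightarrow> (\<exists>h\<in>carrier H. q = act p h)"
    and ind: "diff_induction (P \<times> carrier H) (prod_plots DP DH) (P \<times> P) (prod_plots DP DP)
       (\<lambda>(p, h). (p, act p h))"
    and spaces: "diffeological_space P DP" "diffeological_space X DX"
    by (elim conjE) (rule that)
  show "group H" "diffeological_space (carrier H) DH"
    using grp by (simp_all add: diffeological_group_def)
  show "diffeological_space P DP" "diffeological_space X DX" by (fact spaces)+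
  show "act p a \<in> P" if "p \<in> P" "a \<in> carrier H"
    using act that by (auto simp: smooth_map_def dest: funcset_mem[of _ _ _ "(p, a)"])
  show "act (act p a) b = act p (a \<otimes>\<^bsub>H\<^esub> b)" if "p \<in> P" "a \<in> carrier H" "b \<in> carrier H"
    using mult that by blast
  show "a = b" if "p \<in> P" "a \<in> carrier H" "b \<in> carrier H" "act p a = act p b"
  proof -
    have "inj_on (\<lambda>(p, h). (p, act p h)) (P \<times> carrier H)"
      using ind by (simp add: diff_induction_def)
    from inj_onD[OF this, of "(p, a)" "(p, b)"] that show ?thesis by simp
  qed
  show "\<pi> p = \<pi> q \<longleftrightarrow> (\<exists>a\<in>carrier H. q = act p a)" if "p \<in> P" "q \<in> P"
    using fibres that by blast
qed

lemma local_section_fibre: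
  assumes "principal_bundle H DH P DP act X DX \<pi>"
    and "local_trivialization H DH P DP act DX \<pi> A \<Phi>" "x \<in> A"
  shows "local_section H \<Phi> x \<in> P" "\<pi> (local_section H \<Phi> x) = x"
proof -
  have "\<one>\<^bsub>H\<^esub> \<in> carrier H" using principal_bundleD(1)[OF assms(1)] by (simp add: group.is_monoid)
  then show "local_section H \<Phi> x \<in> P" "\<pi> (local_section H \<Phi> x) = x"
    using assms(2,3)
    unfolding local_trivialization_def local_section_def diffeomorphism_def smooth_map_def by blast+
qed

lemma local_section_smooth:
  assumes "principal_bundle H DH P DP act X DX \<pi>"
    and triv: "local_trivialization H DH P DP act DX \<pi> A \<Phi>"
  shows "smooth_map A (subset_plots DX A) P DP (local_section H \<Phi>)"
  unfolding smooth_map_def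
proof (intro conjI allI impI)
  show "local_section H \<Phi> \<in> A \<rightarrow> P" using local_section_fibre[OF assms] by blast
  fix n V p assume p: "subset_plots DX A n V p"
  interpret H: diffeological_space "carrier H" DH by (rule principal_bundleD(2)[OF assms(1)])
  interpret X: diffeological_space X DX by (rule principal_bundleD(4)[OF assms(1)])
  have "\<one>\<^bsub>H\<^esub> \<in> carrier H" using principal_bundleD(1)[OF assms(1)] by (simp add: group.is_monoid)
  then have "DH n V (\<lambda>_. \<one>\<^bsub>H\<^esub>)"
    using p by (intro H.plot_const) (auto simp: subset_plots_def dest: X.plot_domain)
  with p have "prod_plots (subset_plots DX A) DH n V (\<lambda>v. (p v, \<one>\<^bsub>H\<^esub>))"
    by (simp add: prod_plots_def comp_def)
  with triv have "subset_plots DP {q \<in> P. \<pi> q \<in> A} n V (\<Phi> \<circ> (\<lambda>v. (p v, \<one>\<^bsub>H\<^esub>)))"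
    unfolding local_trivialization_def diffeomorphism_def smooth_map_def by blast
  then show "DP n V (local_section H \<Phi> \<circ> p)"
    by (simp add: subset_plots_def local_section_def comp_def)
qed

lemma smooth_map_subset:
  assumes "smooth_map A (subset_plots DX A) Y DY f" "B \<subseteq> A"
  shows "smooth_map B (subset_plots DX B) Y DY f"
proof -
  have "subset_plots DX A n V p" if "subset_plots DX B n V p" for n V p
    using that assms(2) by (auto simp: subset_plots_def)
  with assms show ?thesis unfolding smooth_map_def by blast
qed

text \<open>
  The map \<open>a\<close> by which two smooth sections differ is smooth, because the action map is an induction:
  \<open>(s, a)\<close> is a plot as soon as its image \<open>(s, s')\<close> is one.
\<close>
lemma section_difference_smooth:
  assumes pb: "principal_bundle H DH P DP act X DX \<pi>"
    and s: "smooth_map A (subset_plots DX A) P DP s" and s': "smooth_map A (subset_plots DX A) P DP s'"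
    and a: "a \<in> A \<rightarrow> carrier H" and eq: "\<And>x. x \<in> A \<Longrightarrow> s' x = act (s x) (a x)"
  shows "smooth_map A (subset_plots DX A) (carrier H) DH a"
  unfolding smooth_map_def
proof (intro conjI allI impI)
  show "a \<in> A \<rightarrow> carrier H" by (rule a)
  fix n V p assume p: "subset_plots DX A n V p"
  interpret P: diffeological_space P DP by (rule principal_bundleD(3)[OF pb])
  have pA: "p \<in> V \<rightarrow> A" using p by (simp add: subset_plots_def)
  have "DP n V (s \<circ> p)" "DP n V (s' \<circ> p)" using s s' p by (auto simp: smooth_map_def)
  moreover from this(2) have "DP n V (\<lambda>v. act (s (p v)) (a (p v)))"
    by (rule P.plot_cong) (simp add: eq funcset_mem[OF pA])
  ultimately have "prod_plots DP DP n V ((\<lambda>(p, h). (p, act p h)) \<circ> (\<lambda>v. (s (p v), a (p v))))"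
    by (simp add: prod_plots_def comp_def)
  moreover have "(\<lambda>v. (s (p v), a (p v))) \<in> V \<rightarrow> P \<times> carrier H"
    using pA a s by (auto simp: smooth_map_def)
  ultimately have "prod_plots DP DH n V (\<lambda>v. (s (p v), a (p v)))"
    using pb unfolding principal_bundle_def diff_induction_def by blast
  then show "DH n V (a \<circ> p)" by (simp add: prod_plots_def comp_def)
qed

text \<open>
  \<open>h\<close> is a cocycle by freeness: \<open>s\<^sub>k\<close> is obtained from \<open>s\<^sub>i\<close> both through \<open>s\<^sub>j\<close> and directly.
\<close>
lemma transition_functions_cocycle:
  assumes pb: "principal_bundle H DH P DP act X DX \<pi>"
    and triv: "trivialized_over H DH P DP act X DX \<pi> I U \<Phi>"
    and trans: "transition_functions H DH act DX I U (\<lambda>i. local_section H (\<Phi> i)) h"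
    and ijk: "i \<in> I" "j \<in> I" "k \<in> I" "x \<in> U i" "x \<in> U j" "x \<in> U k"
  shows "h i j x \<otimes>\<^bsub>H\<^esub> h j k x = h i k x"
proof -
  interpret H: group H by (rule principal_bundleD(1)[OF pb])
  let ?s = "\<lambda>i. local_section H (\<Phi> i) x"
  have hs: "h a b x \<in> carrier H" "?s b = act (?s a) (h a b x)"
    if "a \<in> I" "b \<in> I" "x \<in> U a" "x \<in> U b" for a b
    using trans that unfolding transition_functions_def smooth_map_def by blast+
  have s: "?s i \<in> P"
    using triv ijk by (auto simp: trivialized_over_def intro: local_section_fibre[OF pb])
  have "act (?s i) (h i j x \<otimes>\<^bsub>H\<^esub> h j k x) = act (act (?s i) (h i j x)) (h j k x)"
    using principal_bundleD(6)[OF pb s] hs(1) ijk by simp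
  also have "\<dots> = act (?s i) (h i k x)" using hs(2) ijk by metis
  finally show ?thesis
    using principal_bundleD(7)[OF pb s] hs(1) ijk by simp
qed

text \<open>
  The sections of two trivializations differ at each point by an element of the group; on the
  common refinement of the covers these elements form a smooth nonabelian coboundary between the
  two cocycles of transition functions.
\<close>
lemma trivializations_cohomologous:
  fixes I :: "'i set" and J :: "'j set"
  assumes pb: "principal_bundle H DH P DP act X DX \<pi>"
    and triv: "trivialized_over H DH P DP act X DX \<pi> I U \<Phi>"
    and trans: "transition_functions H DH act DX I U (\<lambda>i. local_section H (\<Phi> i)) h"
    and triv': "trivialized_over H DH P DP act X DX \<pi> J V \<Psi>"
    and trans': "transition_functions H DH act DX J V (\<lambda>i. local_section H (\<Psi> i)) h'"
  obtains a where
    "\<And>i j. \<lbrakk>i \<in> I; j \<in> J\<rbrakk> \<Longrightarrow> smooth_map (U i \<inter> V j) (subset_plots DX (U i \<inter> V j)) (carrier H) DH (a i j)"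
    "\<And>i j k l x. \<lbrakk>i \<in> I; j \<in> J; k \<in> I; l \<in> J; x \<in> U i; x \<in> V j; x \<in> U k; x \<in> V l\<rbrakk>
       \<Longrightarrow> a i j x \<otimes>\<^bsub>H\<^esub> h' j l x = h i k x \<otimes>\<^bsub>H\<^esub> a k l x"
proof -
  interpret H: group H by (rule principal_bundleD(1)[OF pb])
  let ?s = "\<lambda>i. local_section H (\<Phi> i)" and ?s' = "\<lambda>j. local_section H (\<Psi> j)"
  have lt: "local_trivialization H DH P DP act DX \<pi> (U i) (\<Phi> i)" if "i \<in> I" for i
    using triv that by (simp add: trivialized_over_def)
  have lt': "local_trivialization H DH P DP act DX \<pi> (V j) (\<Psi> j)" if "j \<in> J" for j
    using triv' that by (simp add: trivialized_over_def)
  note s = local_section_fibre[OF pb lt] and s' = local_section_fibre[OF pb lt']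
  define a where "a i j x = (SOME b. b \<in> carrier H \<and> ?s' j x = act (?s i x) b)" for i j x
  have a: "a i j x \<in> carrier H" "?s' j x = act (?s i x) (a i j x)"
    if "i \<in> I" "j \<in> J" "x \<in> U i" "x \<in> V j" for i j x
  proof -
    have "\<exists>b. b \<in> carrier H \<and> ?s' j x = act (?s i x) b"
      using principal_bundleD(8)[OF pb s(1)[OF that(1,3)] s'(1)[OF that(2,4)]]
        s(2)[OF that(1,3)] s'(2)[OF that(2,4)] by auto
    from someI_ex[OF this] show "a i j x \<in> carrier H" "?s' j x = act (?s i x) (a i j x)"
      unfolding a_def by auto
  qed
  have hs: "h i k x \<in> carrier H" "?s k x = act (?s i x) (h i k x)"
    if "i \<in> I" "k \<in> I" "x \<in> U i" "x \<in> U k" for i k x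
    using trans that unfolding transition_functions_def smooth_map_def by blast+
  have hs': "h' j l x \<in> carrier H" "?s' l x = act (?s' j x) (h' j l x)"
    if "j \<in> J" "l \<in> J" "x \<in> V j" "x \<in> V l" for j l x
    using trans' that unfolding transition_functions_def smooth_map_def by blast+
  show ?thesis
  proof (rule that[of a])
    fix i j assume ij: "i \<in> I" "j \<in> J"
    show "smooth_map (U i \<inter> V j) (subset_plots DX (U i \<inter> V j)) (carrier H) DH (a i j)"
    proof (rule section_difference_smooth[OF pb])
      show "smooth_map (U i \<inter> V j) (subset_plots DX (U i \<inter> V j)) P DP (?s i)"
        by (rule smooth_map_subset[OF local_section_smooth[OF pb lt[OF ij(1)]]]) simp
      show "smooth_map (U i \<inter> V j) (subset_plots DX (U i \<inter> V j)) P DP (?s' j)"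
        by (rule smooth_map_subset[OF local_section_smooth[OF pb lt'[OF ij(2)]]]) simp
    qed (use a[OF ij] in auto)
  next
    fix i j k l x assume *: "i \<in> I" "j \<in> J" "k \<in> I" "l \<in> J" "x \<in> U i" "x \<in> V j" "x \<in> U k" "x \<in> V l"
    have si: "?s i x \<in> P" using s * by blast
    note assoc = principal_bundleD(6)[OF pb si]
    have "act (?s i x) (a i j x \<otimes>\<^bsub>H\<^esub> h' j l x) = act (act (?s i x) (a i j x)) (h' j l x)"
      by (simp only: assoc[OF a(1)[OF *(1,2,5,6)] hs'(1)[OF *(2,4,6,8)]])
    also have "\<dots> = act (?s k x) (a k l x)" 
      using a(2)[OF *(1,2,5,6)] hs'(2)[OF *(2,4,6,8)] a(2)[OF *(3,4,7,8)] by simp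
    also have "\<dots> = act (?s i x) (h i k x \<otimes>\<^bsub>H\<^esub> a k l x)"
      using hs(2)[OF *(1,3,5,7)] assoc[OF hs(1)[OF *(1,3,5,7)] a(1)[OF *(3,4,7,8)]] by simp
    finally show "a i j x \<otimes>\<^bsub>H\<^esub> h' j l x = h i k x \<otimes>\<^bsub>H\<^esub> a k l x"
      using principal_bundleD(7)[OF pb si] a(1) hs(1) hs'(1) * by simp
  qed
qed

section \<open>The semidirect product with the group of signs\<close>

lemma semidirect_Z2_mult:
  "a \<otimes>\<^bsub>semidirect_Z2 G \<sigma>\<^esub> b = (fst a \<otimes>\<^bsub>G\<^esub> \<sigma> (snd a) (fst b), snd a \<otimes>\<^bsub>Z2\<^esub> snd b)"
  by (simp add: semidirect_Z2_def split_beta)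

lemma smooth_map_semidirect_components:
  assumes "smooth_map A DA (carrier (semidirect_Z2 G \<sigma>)) (prod_plots DG Z2_plots) f"
  shows "smooth_map A DA (carrier G) DG (\<lambda>x. fst (f x))"
    and "smooth_map A DA (carrier Z2) Z2_plots (\<lambda>x. snd (f x))"
proof -
  have "f x \<in> carrier G \<times> carrier Z2" if "x \<in> A" for x
    using assms that by (auto simp: smooth_map_def semidirect_Z2_def)
  moreover have "DG n V (\<lambda>v. fst (f (p v)))" "Z2_plots n V (\<lambda>v. snd (f (p v)))"
    if "DA n V p" for n V p
    using assms that by (simp_all add: smooth_map_def prod_plots_def comp_def)
  ultimately show "smooth_map A DA (carrier G) DG (\<lambda>x. fst (f x))"
    and "smooth_map A DA (carrier Z2) Z2_plots (\<lambda>x. snd (f x))"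
    by (auto simp: smooth_map_def comp_def mem_Times_iff)
qed

lemma sign_locally_constant:
  assumes pb: "principal_bundle (semidirect_Z2 G \<sigma>) (prod_plots DG Z2_plots) P DP act X DX \<pi>"
    and "openin (D_topology X DX) A"
    and "smooth_map A (subset_plots DX A) (carrier (semidirect_Z2 G \<sigma>)) (prod_plots DG Z2_plots) f"
  shows "locally_constant_Z2 X DX A (\<lambda>x. snd (f x))"
proof -
  interpret X: diffeological_space X DX by (rule principal_bundleD(4)[OF pb])
  show ?thesis
    using assms(2) smooth_map_semidirect_components(2)[OF assms(3)]
    by (rule X.smooth_imp_locally_constant_Z2)
qed

lemma sign_cech_cocycle:
  assumes pb: "principal_bundle (semidirect_Z2 G \<sigma>) (prod_plots DG Z2_plots) P DP act X DX \<pi>"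
    and triv: "trivialized_over (semidirect_Z2 G \<sigma>) (prod_plots DG Z2_plots) P DP act X DX \<pi> I U \<Phi>"
    and trans: "transition_functions (semidirect_Z2 G \<sigma>) (prod_plots DG Z2_plots) act DX I U
                  (\<lambda>i. local_section (semidirect_Z2 G \<sigma>) (\<Phi> i)) h"
  shows "cech_cocycle X DX I U (\<lambda>i j x. snd (h i j x))"
  unfolding cech_cocycle_def
proof (intro conjI ballI)
  fix i j assume ij: "i \<in> I" "j \<in> I"
  then have "openin (D_topology X DX) (U i \<inter> U j)"
    using triv by (auto simp: trivialized_over_def open_cover_def)
  with ij trans show "locally_constant_Z2 X DX (U i \<inter> U j) (\<lambda>x. snd (h i j x))"
    unfolding transition_functions_def by (blast intro: sign_locally_constant[OF pb])
next
  fix i j k x assume "i \<in> I" "j \<in> I" "k \<in> I" "x \<in> U i \<inter> U j \<inter> U k"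
  then have "h i j x \<otimes>\<^bsub>semidirect_Z2 G \<sigma>\<^esub> h j k x = h i k x"
    by (intro transition_functions_cocycle[OF pb triv trans]) auto
  from arg_cong[OF this, of snd] show "snd (h i j x) \<otimes>\<^bsub>Z2\<^esub> snd (h j k x) = snd (h i k x)"
    by (simp add: semidirect_Z2_mult)
qed

text \<open>
  The projection of the semidirect product to the signs is a smooth homomorphism, so it turns the
  nonabelian coboundary between two trivializations into an ordinary one.
\<close>
lemma sign_cech_equiv:
  fixes I :: "'i set" and J :: "'j set"
  assumes pb: "principal_bundle (semidirect_Z2 G \<sigma>) (prod_plots DG Z2_plots) P DP act X DX \<pi>"
    and triv: "trivialized_over (semidirect_Z2 G \<sigma>) (prod_plots DG Z2_plots) P DP act X DX \<pi> I U \<Phi>"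
    and trans: "transition_functions (semidirect_Z2 G \<sigma>) (prod_plots DG Z2_plots) act DX I U
                  (\<lambda>i. local_section (semidirect_Z2 G \<sigma>) (\<Phi> i)) h"
    and triv': "trivialized_over (semidirect_Z2 G \<sigma>) (prod_plots DG Z2_plots) P DP act X DX \<pi> J V \<Psi>"
    and trans': "transition_functions (semidirect_Z2 G \<sigma>) (prod_plots DG Z2_plots) act DX J V
                  (\<lambda>i. local_section (semidirect_Z2 G \<sigma>) (\<Psi> i)) h'"
  shows "cech_equiv X DX (I, U, \<lambda>i j x. snd (h i j x)) (J, V, \<lambda>i j x. snd (h' i j x))"
proof -
  let ?H = "semidirect_Z2 G \<sigma>" and ?DH = "prod_plots DG Z2_plots"
  obtain a where smooth: "\<And>i j. \<lbrakk>i \<in> I; j \<in> J\<rbrakk> \<Longrightarrow>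
      smooth_map (U i \<inter> V j) (subset_plots DX (U i \<inter> V j)) (carrier ?H) ?DH (a i j)"
    and eq: "\<And>i j k l x. \<lbrakk>i \<in> I; j \<in> J; k \<in> I; l \<in> J; x \<in> U i; x \<in> V j; x \<in> U k; x \<in> V l\<rbrakk>
       \<Longrightarrow> a i j x \<otimes>\<^bsub>?H\<^esub> h' j l x = h i k x \<otimes>\<^bsub>?H\<^esub> a k l x"
    using trivializations_cohomologous[OF pb triv trans triv' trans'] by blast
  have cover: "open_cover X DX (I \<times> J) (\<lambda>(i, j). U i \<inter> V j)"
    using triv triv' by (simp add: trivialized_over_def open_cover_common_refinement)
  show ?thesis
  proof (rule cech_equivI[OF cover, where r = fst and t = snd and c = "\<lambda>(i, j) x. snd (a i j x)"],
      goal_cases)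
    case (1 k)
    then show ?case by auto
  next
    case (2 k)
    then show ?case
      using open_cover_openin[OF cover 2] smooth
      by (auto intro: sign_locally_constant[OF pb])
  next
    case (3 k l x)
    then have "a (fst k) (snd k) x \<otimes>\<^bsub>?H\<^esub> h' (snd k) (snd l) x
             = h (fst k) (fst l) x \<otimes>\<^bsub>?H\<^esub> a (fst l) (snd l) x"
      by (intro eq) auto
    from arg_cong[OF this, of snd] show ?case
      by (simp add: semidirect_Z2_mult Z2_mult split_beta)
  qed
qed

lemma alpha_class_eq:
  fixes I :: "'i set"
  assumes pb: "principal_bundle (semidirect_Z2 G \<sigma>) (prod_plots DG Z2_plots) P DP act X DX \<pi>"
    and triv: "trivialized_over (semidirect_Z2 G \<sigma>) (prod_plots DG Z2_plots) P DP act X DX \<pi> I U \<Phi>"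
    and trans: "transition_functions (semidirect_Z2 G \<sigma>) (prod_plots DG Z2_plots) act DX I U
                  (\<lambda>i. local_section (semidirect_Z2 G \<sigma>) (\<Phi> i)) h"
  shows "alpha_class (semidirect_Z2 G \<sigma>) (prod_plots DG Z2_plots) P DP act X DX \<pi>
           = cech_class X DX (I, U, \<lambda>i j x. snd (h i j x))"
proof -
  let ?H = "semidirect_Z2 G \<sigma>" and ?DH = "prod_plots DG Z2_plots"
  have same: "cech_class X DX (J, V, \<lambda>i j x. snd (h' i j x)) = cech_class X DX (I, U, \<lambda>i j x. snd (h i j x))"
    if t: "trivialized_over ?H ?DH P DP act X DX \<pi> J V \<Psi>"
      "transition_functions ?H ?DH act DX J V (\<lambda>i. local_section ?H (\<Psi> i)) h'"
    for J :: "'x set set" and V \<Psi> h'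
    using sign_cech_equiv[OF pb t triv trans] sign_cech_cocycle[OF pb t]
      sign_cech_cocycle[OF pb triv trans]
    by (rule cech_class_eqI)
  \<comment> \<open>The definite description ranges over covers indexed by sets of subsets of \<open>X\<close>; the given
      trivialization yields one of these when its cover is indexed by its own members.\<close>
  define m where "m = inv_into I U"
  have m: "m W \<in> I" "U (m W) = W" if "W \<in> U ` I" for W
    using that unfolding m_def by (simp_all add: inv_into_into f_inv_into_f)
  have triv': "trivialized_over ?H ?DH P DP act X DX \<pi> (U ` I) (\<lambda>W. W) (\<lambda>W. \<Phi> (m W))"
    using triv m unfolding trivialized_over_def open_cover_image by metis
  have trans': "transition_functions ?H ?DH act DX (U ` I) (\<lambda>W. W)
      (\<lambda>W. local_section ?H (\<Phi> (m W))) (\<lambda>W W'. h (m W) (m W'))"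
    unfolding transition_functions_def
  proof (intro ballI)
    fix W W' assume W: "W \<in> U ` I" "W' \<in> U ` I"
    show "smooth_map (W \<inter> W') (subset_plots DX (W \<inter> W')) (carrier ?H) ?DH (h (m W) (m W')) \<and>
        (\<forall>x\<in>W \<inter> W'. local_section ?H (\<Phi> (m W')) x = act (local_section ?H (\<Phi> (m W)) x) (h (m W) (m W') x))"
      using trans[unfolded transition_functions_def, rule_format, OF m(1)[OF W(1)] m(1)[OF W(2)]]
      by (simp add: m(2)[OF W(1)] m(2)[OF W(2)])
  qed
  show ?thesis
    unfolding alpha_class_def
  proof (rule the_equality, goal_cases)
    case 1
    show ?case using triv' trans' same[OF triv' trans'] by metis
  next
    case (2 a)
    then show ?case using same by blast
  qed
qed

theorem proposition5p12:
  fixes G :: "('g, 'm) monoid_scheme" and DG :: "'g plots" and \<sigma> :: "int \<Rightarrow> 'g \<Rightarrow> 'g"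
    and X :: "'x set" and DX :: "'x plots"
    and P :: "'p set" and DP :: "'p plots" and act :: "'p \<Rightarrow> 'g \<times> int \<Rightarrow> 'p" and \<pi> :: "'p \<Rightarrow> 'x"
    and I :: "'i set" and U :: "'i \<Rightarrow> 'x set" and \<Phi> :: "'i \<Rightarrow> 'x \<times> ('g \<times> int) \<Rightarrow> 'p"
    and g :: "'i \<Rightarrow> 'i \<Rightarrow> 'x \<Rightarrow> 'g" and \<epsilon> :: "'i \<Rightarrow> 'i \<Rightarrow> 'x \<Rightarrow> int"
  assumes "diffeological_group G DG"
    and "smooth_Z2_action G DG \<sigma>"
    and "principal_bundle (semidirect_Z2 G \<sigma>) (prod_plots DG Z2_plots) P DP act X DX \<pi>"
    and "trivialized_over (semidirect_Z2 G \<sigma>) (prod_plots DG Z2_plots) P DP act X DX \<pi> I U \<Phi>"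
    and "transition_functions (semidirect_Z2 G \<sigma>) (prod_plots DG Z2_plots) act DX I U
           (\<lambda>i. local_section (semidirect_Z2 G \<sigma>) (\<Phi> i)) (\<lambda>i j x. (g i j x, \<epsilon> i j x))"
  shows "cech_cocycle X DX I U \<epsilon> \<and>
    cech_class X DX (I, U, \<epsilon>) \<in> cech_H1 X DX \<and>
    alpha_class (semidirect_Z2 G \<sigma>) (prod_plots DG Z2_plots) P DP act X DX \<pi>
      = cech_class X DX (I, U, \<epsilon>) \<and>
    (\<forall>i\<in>I. \<forall>j\<in>I. \<forall>k\<in>I. \<forall>x\<in>U i \<inter> U j \<inter> U k.
       g i j x \<otimes>\<^bsub>G\<^esub> \<sigma> (\<epsilon> i j x) (g j k x) = g i k x) \<and>
    twisted_cocycle G DG \<sigma> X DX I U \<epsilon> g"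
proof -
  let ?H = "semidirect_Z2 G \<sigma>"
  let ?h = "\<lambda>i j x. (g i j x, \<epsilon> i j x)"
  have cocycle: "cech_cocycle X DX I U \<epsilon>"
    using sign_cech_cocycle[OF assms(3-5)] by simp
  have cover: "open_cover X DX I U" using assms(4) by (simp add: trivialized_over_def)
  have class_eq: "alpha_class ?H (prod_plots DG Z2_plots) P DP act X DX \<pi>
      = cech_class X DX (I, U, \<epsilon>)"
    using alpha_class_eq[OF assms(3-5)] by simp
  have twisted: "g i j x \<otimes>\<^bsub>G\<^esub> \<sigma> (\<epsilon> i j x) (g j k x) = g i k x"
    if "i \<in> I" "j \<in> I" "k \<in> I" "x \<in> U i \<inter> U j \<inter> U k" for i j k x
  proof -
    have "?h i j x \<otimes>\<^bsub>?H\<^esub> ?h j k x = ?h i k x"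
      using that by (intro transition_functions_cocycle[OF assms(3-5)]) auto
    then show ?thesis by (simp add: semidirect_Z2_mult)
  qed
  have smooth: "smooth_map (U i \<inter> U j) (subset_plots DX (U i \<inter> U j)) (carrier G) DG (g i j)"
    if "i \<in> I" "j \<in> I" for i j
  proof -
    have "smooth_map (U i \<inter> U j) (subset_plots DX (U i \<inter> U j)) (carrier ?H)
            (prod_plots DG Z2_plots) (?h i j)"
      using assms(5) that unfolding transition_functions_def by blast
    from smooth_map_semidirect_components(1)[OF this] show ?thesis by simp
  qed
  show ?thesis
    unfolding twisted_cocycle_def
    using cocycle cech_class_in_H1[OF cover cocycle] class_eq twisted smooth by blast
qed

end
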